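(* Let $G$ and $H$ be simple connected graphs, each with at least two vertices. Then the Cartesian product $G \Box H$ and the lexicographic product $G \circ H$ are not isomorphic.
   Context: All graphs are finite, undirected and simple (no loops or multiple edges). For graphs $G$ and $H$, the following products have vertex set $V(G)\times V(H)$. The Cartesian product $G \Box H$: $(x,y)\sim(x',y')$ if either ($x\sim x'$ in $G$ and $y=y'$) or ($x=x'$ and $y\sim y'$ in $H$). The lexicographic product $G\circ H$: $(x,y)\sim(x',y')$ if either $x\sim x'$ in $G$, or ($x=x'$ and $y\sim y'$ in $H$). Two graphs are isomorphic if there is a bijection between their vertex sets that preserves adjacency and non-adjacency. *)

theory Defs
  imports "Graph_Theory.Digraph_Isomorphism"
begin

text \<open>
  A finite simple undirected graph is a \<^locale>\<open>pair_graph\<close>: finitely many vertices, and a symmetric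
  loop-free set of ordered pairs of vertices as arcs. The edge between \<open>x\<close> and \<open>y\<close> is thus the pair
  of arcs \<open>(x, y)\<close> and \<open>(y, x)\<close>, and \<open>x\<close> is adjacent to \<open>y\<close> iff \<open>(x, y)\<close> is an arc.
\<close>

definition cartesian_product ::
    "'a pair_pre_digraph \<Rightarrow> 'b pair_pre_digraph \<Rightarrow> ('a \<times> 'b) pair_pre_digraph" where
  "cartesian_product G H =
    \<lparr> pverts = pverts G \<times> pverts H,
      parcs = {((x, y), (x', y')) | x y x' y'.
        x \<in> pverts G \<and> y \<in> pverts H \<and> x' \<in> pverts G \<and> y' \<in> pverts H \<and>
        ((x, x') \<in> parcs G \<and> y = y' \<or> x = x' \<and> (y, y') \<in> parcs H)} \<rparr>"

definition lexicographic_product ::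
    "'a pair_pre_digraph \<Rightarrow> 'b pair_pre_digraph \<Rightarrow> ('a \<times> 'b) pair_pre_digraph" where
  "lexicographic_product G H =
    \<lparr> pverts = pverts G \<times> pverts H,
      parcs = {((x, y), (x', y')) | x y x' y'.
        x \<in> pverts G \<and> y \<in> pverts H \<and> x' \<in> pverts G \<and> y' \<in> pverts H \<and>
        ((x, x') \<in> parcs G \<or> x = x' \<and> (y, y') \<in> parcs H)} \<rparr>"

lemma pair_graph_iff:
  "pair_graph G \<longleftrightarrow> finite (pverts G) \<and> parcs G \<subseteq> pverts G \<times> pverts G \<and> sym (parcs G) \<and>
    irrefl (parcs G)"
proof
  assume "pair_graph G"
  then interpret pair_graph G .
  show "finite (pverts G) \<and> parcs G \<subseteq> pverts G \<times> pverts G \<and> sym (parcs G) \<and> irrefl (parcs G)"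
    using pair_finite_verts in_arcsD1 in_arcsD2 arcs_symmetric no_loops'
    unfolding sym_def irrefl_def subset_iff by (metis SigmaI surj_pair)
next
  assume *: "finite (pverts G) \<and> parcs G \<subseteq> pverts G \<times> pverts G \<and> sym (parcs G) \<and>
    irrefl (parcs G)"
  then have "finite (parcs G)"
    by (meson finite_SigmaI finite_subset)
  with * show "pair_graph G"
    by unfold_locales (auto simp: symmetric_def irrefl_def)
qed

lemma pair_graph_cartesian_product:
  "pair_graph G \<Longrightarrow> pair_graph H \<Longrightarrow> pair_graph (cartesian_product G H)"
  unfolding pair_graph_iff cartesian_product_def sym_def irrefl_def by auto

lemma pair_graph_lexicographic_product:
  "pair_graph G \<Longrightarrow> pair_graph H \<Longrightarrow> pair_graph (lexicographic_product G H)"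
  unfolding pair_graph_iff lexicographic_product_def sym_def irrefl_def by auto

text \<open>
  The library's \<^const>\<open>digraph_iso\<close> is stated for multidigraphs, with a separate map on arcs. On
  graphs without parallel arcs it asks for a bijection of the vertices that preserves adjacency and
  non-adjacency.
\<close>

lemma digraph_iso_with_proj_iff:
  assumes "pair_graph G" "pair_graph H"
  shows "digraph_iso (with_proj G) (with_proj H) \<longleftrightarrow>
    (\<exists>f. bij_betw f (pverts G) (pverts H) \<and>
      (\<forall>u \<in> pverts G. \<forall>v \<in> pverts G. (u, v) \<in> parcs G \<longleftrightarrow> (f u, f v) \<in> parcs H))"
    (is "?L \<longleftrightarrow> ?R")
proof
  interpret G: pair_graph G by fact
  assume ?L
  then obtain h where h: "G.digraph_isomorphism h" and H: "with_proj H = app_iso h (with_proj G)"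
    unfolding digraph_iso_def by blast
  define f where "f = iso_verts h"
  have inj: "inj_on f (pverts G)"
    using G.digraph_isomorphism_inj_on_verts[OF h] by (simp add: f_def)
  have V: "pverts H = f ` pverts G"
    using arg_cong[OF H, of verts] by (simp add: f_def)
  have A: "parcs H = (\<lambda>(u, v). (f u, f v)) ` parcs G"
    using arg_cong[OF H, of arcs_ends] G.arcs_ends_app_iso_eq[OF h] by (simp add: f_def)
  have "(u, v) \<in> parcs G \<longleftrightarrow> (f u, f v) \<in> parcs H" if "u \<in> pverts G" "v \<in> pverts G" for u v
  proof
    assume "(f u, f v) \<in> parcs H"
    then obtain a b where ab: "(a, b) \<in> parcs G" "f u = f a" "f v = f b"
      using A by auto
    with that inj have "u = a" "v = b"
      using G.in_arcsD1[OF ab(1)] G.in_arcsD2[OF ab(1)] by (auto dest: inj_onD)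
    with ab show "(u, v) \<in> parcs G"
      by simp
  qed (use A in auto)
  with inj V show ?R
    by (auto simp: bij_betw_def)
next
  interpret G: pair_graph G by fact
  interpret H: pair_graph H by fact
  assume ?R
  then obtain f where f: "inj_on f (pverts G)" "f ` pverts G = pverts H"
    and adj: "\<And>u v. u \<in> pverts G \<Longrightarrow> v \<in> pverts G \<Longrightarrow>
      (u, v) \<in> parcs G \<longleftrightarrow> (f u, f v) \<in> parcs H"
    by (auto simp: bij_betw_def)
  define h where "h = \<lparr> iso_verts = f, iso_arcs = map_prod f f, iso_head = snd, iso_tail = fst \<rparr>"
  have "inj_on (map_prod f f) (parcs G)"
    by (rule inj_on_subset[OF map_prod_inj_on[OF f(1) f(1)]]) (auto dest: G.in_arcsD1 G.in_arcsD2)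
  then have "G.digraph_isomorphism h"
    using f(1) G.wf_digraph by (auto simp: G.digraph_isomorphism_def h_def)
  moreover have "map_prod f f ` parcs G = parcs H"
  proof (intro equalityI subsetI)
    fix e assume "e \<in> map_prod f f ` parcs G"
    then show "e \<in> parcs H"
      using adj by (auto dest: G.in_arcsD1 G.in_arcsD2)
  next
    fix e assume e: "e \<in> parcs H"
    then have "fst e \<in> f ` pverts G" "snd e \<in> f ` pverts G"
      using f(2) H.arc_fst_in_verts H.arc_snd_in_verts by auto
    then obtain u v where uv: "u \<in> pverts G" "v \<in> pverts G" "e = (f u, f v)"
      by (metis imageE prod.collapse)
    with adj e have "(u, v) \<in> parcs G"
      by blast
    with uv show "e \<in> map_prod f f ` parcs G"
      by force
  qed
  then have "with_proj H = app_iso h (with_proj G)"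
    using f(2) by (simp add: app_iso_def h_def with_proj_def)
  ultimately show ?L
    unfolding digraph_iso_def by blast
qed

end

theory Submission
  imports Defs
begin

text \<open>
  On the common vertex set, every arc of the Cartesian product is an arc of the lexicographic
  product. If \<open>G\<close> has an arc \<open>(x, x')\<close> and \<open>H\<close> two vertices \<open>y \<noteq> y'\<close>, then \<open>(x, y)\<close> and \<open>(x', y')\<close> are
  adjacent only in the lexicographic product. So the latter has more arcs, and finite isomorphic
  graphs have equally many.
\<close>

lemma card_ge_2_distinct:
  assumes "card A \<ge> 2"
  obtains a b where "a \<in> A" and "b \<in> A" and "a \<noteq> b"
proof -
  \<comment> \<open>\<open>card\<close> is 0 on infinite sets, so the bound forces
    finiteness.\<close>
  have "finite A" and "\<not> card A \<le> Suc 0"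
    using assms by (auto intro: card_ge_0_finite)
  then show thesis
    using that by (auto simp: card_le_Suc0_iff_eq)
qed

text \<open>An isomorphism moves the arcs by \<open>iso_arcs h\<close>, which is injective on
  \<open>arcs G\<close>; injective images keep their cardinality.\<close>

lemma digraph_iso_card_arcs:
  assumes "digraph_iso G H"
  shows "card (arcs G) = card (arcs H)"
proof -
  from assms obtain h where "pre_digraph.digraph_isomorphism G h" and "H = app_iso h G"
    unfolding digraph_iso_def by blast
  then show ?thesis
    by (simp add: pre_digraph.digraph_isomorphism_def card_image)
qed

text \<open>\<open>connected\<close> means strong connectivity of the symmetric closure
  \<open>mk_symmetric G\<close>, which has no arcs if \<open>G\<close> has none. A walk between
  distinct vertices needs a last arc.\<close>

lemma (in wf_digraph) connected_arcs_nonempty: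
  assumes "connected G" and "u \<in> verts G" and "v \<in> verts G" and "u \<noteq> v"
  shows "arcs G \<noteq> {}"
proof
  assume "arcs G = {}"
  then have no_arcs: "parcs (mk_symmetric G) = {}"
    by (auto simp: mk_symmetric_def arcs_ends_def)
  have "u \<rightarrow>\<^sup>*\<^bsub>with_proj (mk_symmetric G)\<^esub> v"
    using assms by (auto simp: connected_def elim: strongly_connectedE)
  then show False
    unfolding reachable_def using \<open>u \<noteq> v\<close> no_arcs by (cases rule: rtrancl_on.cases) auto
qed

lemma parcs_cartesian_product_psubset:
  assumes "irrefl (parcs G)" and "(x, x') \<in> parcs G" and "x \<in> pverts G" and "x' \<in> pverts G"
    and "y \<in> pverts H" and "y' \<in> pverts H" and "y \<noteq> y'"
  shows "parcs (cartesian_product G H) \<subset> parcs (lexicographic_product G H)"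
proof
  show "parcs (cartesian_product G H) \<subseteq> parcs (lexicographic_product G H)"
    by (auto simp: cartesian_product_def lexicographic_product_def)
  have "((x, y), (x', y')) \<in> parcs (lexicographic_product G H)"
    using assms by (simp add: lexicographic_product_def)
  \<comment> \<open>Irreflexivity gives \<open>x \<noteq> x'\<close>, so both coordinates change,
    whereas a Cartesian arc fixes one of them.\<close>
  moreover have "((x, y), (x', y')) \<notin> parcs (cartesian_product G H)"
    using assms by (auto simp: cartesian_product_def irrefl_def)
  ultimately show "parcs (cartesian_product G H) \<noteq> parcs (lexicographic_product G H)"
    by blast
qed

theorem theorem3p5:
  fixes G :: "'a pair_pre_digraph" and H :: "'b pair_pre_digraph"
  assumes "pair_graph G" and "Digraph_Component.connected (with_proj G)" and "card (pverts G) \<ge> 2"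
    and "pair_graph H" and "Digraph_Component.connected (with_proj H)" and "card (pverts H) \<ge> 2"
  shows "\<not> digraph_iso (with_proj (cartesian_product G H)) (with_proj (lexicographic_product G H))"
proof
  assume iso: "digraph_iso (with_proj (cartesian_product G H))
    (with_proj (lexicographic_product G H))"
  interpret G: pair_graph G by fact
  \<comment> \<open>This supplies finiteness of the larger arc set, so that strict inclusion yields
    a strictly smaller cardinality.\<close>
  interpret L: pair_graph "lexicographic_product G H"
    using assms by (intro pair_graph_lexicographic_product)
  obtain u v where "u \<in> pverts G" "v \<in> pverts G" "u \<noteq> v"
    using assms(3) by (rule card_ge_2_distinct)
  then have "parcs G \<noteq> {}"
    using G.connected_arcs_nonempty[OF assms(2)] by simp
  then obtain x x' where x: "(x, x') \<in> parcs G" "x \<in> pverts G" "x' \<in> pverts G"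
    using G.in_arcsD1 G.in_arcsD2 by fast
  obtain y y' where y: "y \<in> pverts H" "y' \<in> pverts H" "y \<noteq> y'"
    using assms(6) by (rule card_ge_2_distinct)
  have "irrefl (parcs G)"
    using assms(1) by (simp add: pair_graph_iff)
  then have "card (parcs (cartesian_product G H)) < card (parcs (lexicographic_product G H))"
    using parcs_cartesian_product_psubset x y L.pair_finite_arcs by (metis psubset_card_mono)
  with digraph_iso_card_arcs[OF iso] show False
    by simp
qed

end
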